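(* Suppose $F:\mathbb{R}^d\to\mathbb{R}^d$ is monotone and $1$-symmetric $(L_0,L_1)$-Lipschitz, with $F(x_* )=0$. Then the extragradient method with step sizes $\gamma_k=\omega_k=\frac{\nu}{L_0+L_1\|F(x_k)\|}$, where $\nu\exp(\nu)=\frac1{\sqrt2}$, satisfies for all $K\ge0$ $$\min_{0\le k\le K}\|F(x_k)\|^2\le\frac{2L_0^2\left(1+L_1\exp\left(L_1\|x_0-x_*\|\right)\|x_0-x_*\|\right)^2\|x_0-x_*\|^2}{\nu^2(K+1)}.$$
   Context: Extragradient method (EG): $\hat x_k=x_k-\gamma_kF(x_k)$, $x_{k+1}=x_k-\omega_kF(\hat x_k)$, started from $x_0\in\mathbb{R}^d$. $F$ is $1$-symmetric $(L_0,L_1)$-Lipschitz ($L_0,L_1\ge0$) if for all $x,y$: $\|F(x)-F(y)\|\le\left(L_0+L_1\max_{\theta\in[0,1]}\|F(\theta x+(1-\theta)y)\|\right)\|x-y\|$. Monotone: $\langle F(x)-F(y),x-y\rangle\ge0$ for all $x,y$. *)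

theory Defs
  imports "HOL-Analysis.Analysis"
begin

definition monotone_operator :: "('a::real_inner \<Rightarrow> 'a) \<Rightarrow> bool" where
  "monotone_operator F \<longleftrightarrow> (\<forall>x y. inner (F x - F y) (x - y) \<ge> 0)"

definition is_max :: "real set \<Rightarrow> real \<Rightarrow> bool" where
  "is_max S M \<longleftrightarrow> M \<in> S \<and> (\<forall>r\<in>S. r \<le> M)"

text \<open>The maximum over the segment is required to exist: \<open>Max\<close> is unspecified on infinite
  sets and \<open>Sup\<close> on unbounded ones, so neither would express the inequality without a
  side condition. Where the maximum exists, the value \<open>M\<close> is unique.\<close>

definition one_symmetric_Lipschitz :: "real \<Rightarrow> real \<Rightarrow> ('a::real_normed_vector \<Rightarrow> 'a) \<Rightarrow> bool" where
  "one_symmetric_Lipschitz L0 L1 F \<longleftrightarrow> 0 \<le> L0 \<and> 0 \<le> L1 \<and>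
     (\<forall>x y. \<exists>M. is_max ((\<lambda>\<theta>. norm (F (\<theta> *\<^sub>R x + (1 - \<theta>) *\<^sub>R y))) ` {0..1}) M \<and>
        norm (F x - F y) \<le> (L0 + L1 * M) * norm (x - y))"

definition extragradient ::
  "('a::real_vector \<Rightarrow> 'a) \<Rightarrow> (nat \<Rightarrow> real) \<Rightarrow> (nat \<Rightarrow> real) \<Rightarrow> (nat \<Rightarrow> 'a) \<Rightarrow> (nat \<Rightarrow> 'a) \<Rightarrow> bool" where
  "extragradient F \<gamma> \<omega> x xhat \<longleftrightarrow>
     (\<forall>k. xhat k = x k - \<gamma> k *\<^sub>R F (x k) \<and> x (Suc k) = x k - \<omega> k *\<^sub>R F (xhat k))"

end

theory Submission
  imports Defs
begin

text \<open>
  Along a segment the condition bounds the local Lipschitz constant at \<open>z\<close> by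
  \<open>L0 + L1 * norm (F z)\<close>, and this quantity itself grows at a rate of at most \<open>L1\<close> times itself.
  A Gronwall argument therefore replaces the unknown maximum by an exponential
  (\<open>one_symmetric_Lipschitz_exp\<close>):
  \<open>norm (F x - F y) \<le> (L0 + L1 * norm (F y)) * exp (L1 * norm (x - y)) * norm (x - y)\<close>.

  This estimate is used twice. Between \<open>x\<^sub>k\<close> and the extrapolated point, whose distance is
  \<open>\<gamma>\<^sub>k * norm (F x\<^sub>k)\<close>, the step size turns it into
  \<open>norm (F xhat\<^sub>k - F x\<^sub>k) \<le> \<nu> * exp \<nu> * norm (F x\<^sub>k)\<close>. Monotonicity bounds the new squared distance to
  the solution by the old one plus
  \<open>\<gamma>\<^sub>k\<^sup>2 * ((norm (F xhat\<^sub>k - F x\<^sub>k))\<^sup>2 - (norm (F x\<^sub>k))\<^sup>2)\<close>, so the value \<open>1 / sqrt 2\<close> of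
  \<open>\<nu> * exp \<nu>\<close> makes the squared distance drop by half of
  \<open>\<gamma>\<^sub>k\<^sup>2 * (norm (F x\<^sub>k))\<^sup>2\<close> (\<open>extragradient_step_decrease\<close>), and these drops sum to at most the
  initial squared distance.

  Between \<open>x\<^sub>k\<close> and the solution, where \<open>F\<close> vanishes, the same estimate bounds \<open>norm (F x\<^sub>k)\<close> in
  terms of the initial distance, because the distances do not increase. Hence the step sizes are
  bounded away from zero (\<open>step_size_lower_bound\<close>), and averaging the drops gives the rate.
\<close>

section \<open>From the maximum over a segment to an exponential bound\<close>

text \<open>
  On a short segment the maximum \<open>M\<close> can be absorbed: it is attained at some point \<open>w\<close>, and the
  condition between \<open>w\<close> and \<open>y\<close>, whose segment lies inside the original one, bounds \<open>M\<close> by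
  \<open>norm (F y)\<close> plus a small multiple of \<open>L0 + L1 * M\<close>.
\<close>

lemma one_symmetric_Lipschitz_short:
  fixes F :: "'a::real_normed_vector \<Rightarrow> 'a"
  assumes F: "one_symmetric_Lipschitz L0 L1 F"
    and short: "L1 * norm (x - y) < 1"
  shows "norm (F x - F y) \<le> (L0 + L1 * norm (F y)) / (1 - L1 * norm (x - y)) * norm (x - y)"
proof -
  define d where "d = norm (x - y)"
  have L: "0 \<le> L0" "0 \<le> L1" and
    ex: "\<And>x y. \<exists>M. is_max ((\<lambda>\<theta>. norm (F (\<theta> *\<^sub>R x + (1 - \<theta>) *\<^sub>R y))) ` {0..1}) M \<and>
        norm (F x - F y) \<le> (L0 + L1 * M) * norm (x - y)"
    using F unfolding one_symmetric_Lipschitz_def by auto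
  obtain M where M: "is_max ((\<lambda>\<theta>. norm (F (\<theta> *\<^sub>R x + (1 - \<theta>) *\<^sub>R y))) ` {0..1}) M"
    and xy: "norm (F x - F y) \<le> (L0 + L1 * M) * d"
    using ex[of x y] unfolding d_def by auto
  have max: "norm (F (\<theta> *\<^sub>R x + (1 - \<theta>) *\<^sub>R y)) \<le> M" if "0 \<le> \<theta>" "\<theta> \<le> 1" for \<theta>
    using M that unfolding is_max_def by auto
  have M0: "0 \<le> M"
    using max[of 0] by (intro order_trans[OF norm_ge_zero]) auto
  obtain \<theta> where \<theta>: "0 \<le> \<theta>" "\<theta> \<le> 1" and M_eq: "M = norm (F (\<theta> *\<^sub>R x + (1 - \<theta>) *\<^sub>R y))"
    using M unfolding is_max_def by auto
  define w where "w = \<theta> *\<^sub>R x + (1 - \<theta>) *\<^sub>R y"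
  have wy: "w - y = \<theta> *\<^sub>R (x - y)"
    by (simp add: w_def algebra_simps)
  obtain M' where M': "is_max ((\<lambda>\<theta>. norm (F (\<theta> *\<^sub>R w + (1 - \<theta>) *\<^sub>R y))) ` {0..1}) M'"
    and Fwy: "norm (F w - F y) \<le> (L0 + L1 * M') * norm (w - y)"
    using ex[of w y] by auto
  obtain \<theta>' where \<theta>': "0 \<le> \<theta>'" "\<theta>' \<le> 1" and M'_eq: "M' = norm (F (\<theta>' *\<^sub>R w + (1 - \<theta>') *\<^sub>R y))"
    using M' unfolding is_max_def by auto
  have "\<theta>' *\<^sub>R w + (1 - \<theta>') *\<^sub>R y = (\<theta>' * \<theta>) *\<^sub>R x + (1 - \<theta>' * \<theta>) *\<^sub>R y"
    by (simp add: w_def algebra_simps)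
  then have M'M: "M' \<le> M"
    using max[of "\<theta>' * \<theta>"] \<theta> \<theta>' M'_eq by (simp add: mult_le_one)
  have "(L0 + L1 * M') * norm (w - y) \<le> (L0 + L1 * M) * d"
  proof (rule mult_mono)
    show "L0 + L1 * M' \<le> L0 + L1 * M"
      using M'M L by (simp add: mult_left_mono)
    show "norm (w - y) \<le> d"
      using \<theta> by (simp add: wy d_def mult_left_le_one_le)
    show "0 \<le> L0 + L1 * M"
      using L M0 by simp
  qed simp
  moreover have "M \<le> norm (F y) + norm (F w - F y)"
    using M_eq norm_triangle_ineq[of "F y" "F w - F y"] by (simp add: w_def)
  ultimately have "M \<le> norm (F y) + (L0 + L1 * M) * d"
    using Fwy by linarith
  then have "L1 * M \<le> L1 * (norm (F y) + (L0 + L1 * M) * d)"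
    using L by (simp add: mult_left_mono)
  then have "(L0 + L1 * M) * (1 - L1 * d) \<le> L0 + L1 * norm (F y)"
    by (simp add: algebra_simps)
  then have "L0 + L1 * M \<le> (L0 + L1 * norm (F y)) / (1 - L1 * d)"
    using short by (simp add: d_def pos_le_divide_eq)
  then have "(L0 + L1 * M) * d \<le> (L0 + L1 * norm (F y)) / (1 - L1 * d) * d"
    by (rule mult_right_mono) (simp add: d_def)
  then show ?thesis
    using xy unfolding d_def by linarith
qed

text \<open>
  This is Gronwall's inequality in discrete form: cutting the segment into \<open>n\<close> equal pieces, each
  piece multiplies \<open>L0 + L1 * norm (F z)\<close> by at most \<open>q = 1 / (1 - L1 * norm (x - y) / n)\<close>. Working
  with pieces needs neither derivatives nor a separate treatment of \<open>L1 = 0\<close>.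
\<close>

lemma one_symmetric_Lipschitz_subdivided:
  fixes F :: "'a::real_normed_vector \<Rightarrow> 'a"
  assumes F: "one_symmetric_Lipschitz L0 L1 F"
    and n: "n > 0" "L1 * norm (x - y) < real n"
  shows "norm (F x - F y)
    \<le> (L0 + L1 * norm (F y)) * norm (x - y) / (1 - L1 * norm (x - y) / real n) ^ n"
proof -
  define d where "d = norm (x - y) / real n"
  define q where "q = 1 / (1 - L1 * d)"
  define z where "z i = y + (real i / real n) *\<^sub>R (x - y)" for i
  define A where "A i = L0 + L1 * norm (F (z i))" for i
  have L: "0 \<le> L0" "0 \<le> L1"
    using F unfolding one_symmetric_Lipschitz_def by auto
  have d0: "0 \<le> d"
    by (simp add: d_def)
  have Ld: "L1 * d < 1"
    using n by (simp add: d_def field_simps)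
  have q1: "1 \<le> q"
    using Ld L d0 by (simp add: q_def)
  have q_eq: "1 + L1 * d * q = q"
    using Ld by (simp add: q_def field_simps)
  have A0: "0 \<le> A i" for i
    using L by (simp add: A_def)
  have "z (Suc i) - z i = (1 / real n) *\<^sub>R (x - y)" for i
    by (simp add: z_def add_divide_distrib scaleR_left_distrib)
  then have dist_z: "norm (z (Suc i) - z i) = d" for i
    by (simp add: d_def)
  have piece: "norm (F (z (Suc i)) - F (z i)) \<le> A i * q * d" for i
    using one_symmetric_Lipschitz_short[OF F, of "z (Suc i)" "z i"] Ld
    by (simp add: dist_z A_def q_def)
  have A_Suc: "A (Suc i) \<le> A i * q" for i
  proof -
    have "norm (F (z (Suc i))) \<le> norm (F (z i)) + A i * q * d"
      using piece[of i] norm_triangle_ineq2[of "F (z (Suc i))" "F (z i)"] by linarith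
    then have "L1 * norm (F (z (Suc i))) \<le> L1 * (norm (F (z i)) + A i * q * d)"
      using L by (simp add: mult_left_mono)
    then have "A (Suc i) \<le> A i * (1 + L1 * d * q)"
      by (simp add: A_def algebra_simps)
    then show ?thesis
      by (simp add: q_eq)
  qed
  have A_pow: "A i \<le> A 0 * q ^ i" for i
  proof (induction i)
    case (Suc i)
    have "A i * q \<le> A 0 * q ^ i * q"
      using Suc q1 by (intro mult_right_mono) auto
    then show ?case
      using A_Suc[of i] by (simp add: mult.assoc mult.commute[of q])
  qed simp
  have total: "norm (F (z i) - F (z 0)) \<le> real i * (d * (A 0 * q ^ i))" for i
  proof (induction i)
    case (Suc i)
    have "A i * q * d \<le> A 0 * q ^ i * q * d"
      using A_pow[of i] q1 d0 by (intro mult_right_mono) auto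
    then have "norm (F (z (Suc i)) - F (z i)) \<le> d * (A 0 * q ^ Suc i)"
      using piece[of i] by (simp add: mult_ac)
    moreover have "real i * (d * (A 0 * q ^ i)) \<le> real i * (d * (A 0 * q ^ Suc i))"
      using q1 d0 A0 by (intro mult_left_mono power_increasing) auto
    moreover have "norm (F (z (Suc i)) - F (z 0))
        \<le> norm (F (z (Suc i)) - F (z i)) + norm (F (z i) - F (z 0))"
      using norm_triangle_ineq[of "F (z (Suc i)) - F (z i)" "F (z i) - F (z 0)"] by simp
    ultimately show ?case
      using Suc by (simp add: algebra_simps)
  qed simp
  have "z n = x" "z 0 = y"
    using n by (auto simp: z_def)
  moreover have "real n * d = norm (x - y)"
    using n by (simp add: d_def)
  ultimately have "norm (F x - F y) \<le> norm (x - y) * ((L0 + L1 * norm (F y)) * q ^ n)"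
    using total[of n] by (simp add: A_def mult.assoc[symmetric])
  then show ?thesis
    by (simp add: q_def d_def power_divide mult.commute)
qed

lemma one_symmetric_Lipschitz_exp:
  fixes F :: "'a::real_normed_vector \<Rightarrow> 'a"
  assumes F: "one_symmetric_Lipschitz L0 L1 F"
  shows "norm (F x - F y) \<le> (L0 + L1 * norm (F y)) * exp (L1 * norm (x - y)) * norm (x - y)"
proof -
  define c where "c = L1 * norm (x - y)"
  have "(\<lambda>n. (1 + - c / real n) ^ n) \<longlonglongrightarrow> exp (- c)"
    by (rule tendsto_exp_limit_sequentially)
  then have "(\<lambda>n. (L0 + L1 * norm (F y)) * norm (x - y) / (1 + - c / real n) ^ n)
      \<longlonglongrightarrow> (L0 + L1 * norm (F y)) * norm (x - y) / exp (- c)"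
    by (intro tendsto_intros) auto
  moreover have "\<forall>\<^sub>F n in sequentially. norm (F x - F y)
      \<le> (L0 + L1 * norm (F y)) * norm (x - y) / (1 + - c / real n) ^ n"
  proof -
    obtain N :: nat where N: "c < real N"
      using reals_Archimedean2 by blast
    show ?thesis
      using eventually_ge_at_top[of "Suc N"]
    proof eventually_elim
      case (elim n)
      then show ?case
        using one_symmetric_Lipschitz_subdivided[OF F, of n x y] N by (simp add: c_def)
    qed
  qed
  ultimately have "norm (F x - F y) \<le> (L0 + L1 * norm (F y)) * norm (x - y) / exp (- c)"
    by (rule tendsto_lowerbound) simp
  then show ?thesis
    by (simp add: c_def exp_minus field_simps)
qed

lemma norm_le_exp_dist_zero:
  fixes F :: "'a::real_normed_vector \<Rightarrow> 'a"
  assumes "one_symmetric_Lipschitz L0 L1 F" and "F xs = 0"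
  shows "norm (F x) \<le> L0 * exp (L1 * norm (x - xs)) * norm (x - xs)"
  using one_symmetric_Lipschitz_exp[OF assms(1), of x xs] assms(2) by simp

section \<open>The extragradient step\<close>

text \<open>
  Monotonicity at the extrapolated point compares only \<open>u - xs\<close> with \<open>F u\<close>; the remaining part
  \<open>\<gamma> *\<^sub>R F x\<close> of \<open>x - xs\<close> turns the cross term into \<open>2 * \<gamma>\<^sup>2 * inner (F u) (F x)\<close>, and the square is
  completed.
\<close>

lemma extragradient_step_monotone:
  fixes F :: "'a::real_inner \<Rightarrow> 'a"
  assumes F: "monotone_operator F" and xs: "F xs = 0" and \<gamma>: "0 \<le> \<gamma>"
    and u: "u = x - \<gamma> *\<^sub>R F x"
  shows "(norm (x - \<gamma> *\<^sub>R F u - xs))\<^sup>2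
    \<le> (norm (x - xs))\<^sup>2 + \<gamma>\<^sup>2 * ((norm (F u - F x))\<^sup>2 - (norm (F x))\<^sup>2)"
proof -
  have mono: "0 \<le> inner (F u) (u - xs)"
    using F xs unfolding monotone_operator_def by (metis diff_zero)
  have "x - xs = (u - xs) + \<gamma> *\<^sub>R F x"
    using u by simp
  then have "inner (F u) (x - xs) = inner (F u) (u - xs) + \<gamma> * inner (F u) (F x)"
    by (simp only: inner_add_right inner_scaleR_right)
  then have cross: "\<gamma> * (\<gamma> * inner (F u) (F x)) \<le> \<gamma> * inner (F u) (x - xs)"
    using mono \<gamma> by (intro mult_left_mono) auto
  have expand: "(norm (a - \<gamma> *\<^sub>R b))\<^sup>2 = (norm a)\<^sup>2 - 2 * (\<gamma> * inner b a) + \<gamma>\<^sup>2 * (norm b)\<^sup>2" for a b :: 'a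
    unfolding power2_norm_eq_inner
    by (simp add: inner_diff_left inner_diff_right inner_commute[of a b] power2_eq_square
        right_diff_distrib)
  have "x - \<gamma> *\<^sub>R F u - xs = (x - xs) - \<gamma> *\<^sub>R F u"
    by simp
  then have "(norm (x - \<gamma> *\<^sub>R F u - xs))\<^sup>2
      = (norm (x - xs))\<^sup>2 - 2 * (\<gamma> * inner (F u) (x - xs)) + \<gamma>\<^sup>2 * (norm (F u))\<^sup>2"
    by (simp only: expand)
  moreover have "(norm (F u - F x))\<^sup>2 - (norm (F x))\<^sup>2 = (norm (F u))\<^sup>2 - 2 * inner (F u) (F x)"
    unfolding power2_norm_eq_inner by (simp add: inner_diff_left inner_diff_right inner_commute)
  then have "\<gamma>\<^sup>2 * ((norm (F u - F x))\<^sup>2 - (norm (F x))\<^sup>2)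
      = \<gamma>\<^sup>2 * (norm (F u))\<^sup>2 - 2 * (\<gamma> * (\<gamma> * inner (F u) (F x)))"
    by (simp add: power2_eq_square right_diff_distrib)
  ultimately show ?thesis
    using cross by linarith
qed

text \<open>
  The step size is bounded only from above, so that the estimate also covers a step of size zero,
  which is the value of \<open>\<nu> / (L0 + L1 * norm (F x))\<close> when the denominator vanishes.
\<close>

lemma extragradient_step_decrease:
  fixes F :: "'a::real_inner \<Rightarrow> 'a"
  assumes mono: "monotone_operator F" and lip: "one_symmetric_Lipschitz L0 L1 F"
    and xs: "F xs = 0" and \<nu>: "\<nu> * exp \<nu> = 1 / sqrt 2"
    and \<gamma>: "0 \<le> \<gamma>" "\<gamma> * (L0 + L1 * norm (F x)) \<le> \<nu>"
    and u: "u = x - \<gamma> *\<^sub>R F x"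
  shows "(norm (x - \<gamma> *\<^sub>R F u - xs))\<^sup>2 \<le> (norm (x - xs))\<^sup>2 - \<gamma>\<^sup>2 * (norm (F x))\<^sup>2 / 2"
proof -
  have L: "0 \<le> L0" "0 \<le> L1"
    using lip unfolding one_symmetric_Lipschitz_def by auto
  have dist: "norm (u - x) = \<gamma> * norm (F x)"
    using u \<gamma> by simp
  have "0 \<le> \<gamma> * L0"
    using \<gamma> L by simp
  then have "L1 * (\<gamma> * norm (F x)) \<le> \<nu>"
    using \<gamma> by (simp add: algebra_simps)
  then have "(\<gamma> * (L0 + L1 * norm (F x))) * exp (L1 * (\<gamma> * norm (F x))) \<le> \<nu> * exp \<nu>"
    using \<gamma> L by (intro mult_mono order_trans[OF _ \<gamma>(2)]) auto
  then have "(\<gamma> * (L0 + L1 * norm (F x))) * exp (L1 * (\<gamma> * norm (F x))) * norm (F x)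
      \<le> 1 / sqrt 2 * norm (F x)"
    unfolding \<nu> by (rule mult_right_mono) simp
  moreover have "norm (F u - F x)
      \<le> (\<gamma> * (L0 + L1 * norm (F x))) * exp (L1 * (\<gamma> * norm (F x))) * norm (F x)"
    using one_symmetric_Lipschitz_exp[OF lip, of u x] unfolding dist by (simp add: mult_ac)
  ultimately have "norm (F u - F x) \<le> norm (F x) / sqrt 2"
    by simp
  then have "(norm (F u - F x))\<^sup>2 \<le> (norm (F x) / sqrt 2)\<^sup>2"
    by (rule power_mono) simp
  then have "(norm (F u - F x))\<^sup>2 - (norm (F x))\<^sup>2 \<le> - ((norm (F x))\<^sup>2 / 2)"
    by (simp add: power_divide)
  then have "\<gamma>\<^sup>2 * ((norm (F u - F x))\<^sup>2 - (norm (F x))\<^sup>2) \<le> \<gamma>\<^sup>2 * - ((norm (F x))\<^sup>2 / 2)"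
    by (rule mult_left_mono) simp
  then show ?thesis
    using extragradient_step_monotone[OF mono xs \<gamma>(1) u] by simp
qed

text \<open>
  The factor \<open>norm (F x)\<close> on both sides keeps the bound true when the denominator of the step size
  vanishes: then \<open>L0 = 0\<close>, and the exponential bound at the zero \<open>xs\<close> forces \<open>F x = 0\<close>.
\<close>

lemma step_size_lower_bound:
  fixes F :: "'a::real_normed_vector \<Rightarrow> 'a"
  assumes lip: "one_symmetric_Lipschitz L0 L1 F" and xs: "F xs = 0" and \<nu>: "0 < \<nu>"
    and D: "norm (x - xs) \<le> D"
  shows "\<nu> * norm (F x)
    \<le> L0 * (1 + L1 * exp (L1 * D) * D) * (\<nu> / (L0 + L1 * norm (F x)) * norm (F x))"
proof -
  have L: "0 \<le> L0" "0 \<le> L1"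
    using lip unfolding one_symmetric_Lipschitz_def by auto
  have "exp (L1 * norm (x - xs)) * norm (x - xs) \<le> exp (L1 * D) * D"
    using D L by (intro mult_mono) (auto simp: mult_left_mono)
  then have "L0 * (exp (L1 * norm (x - xs)) * norm (x - xs)) \<le> L0 * (exp (L1 * D) * D)"
    using L by (intro mult_left_mono)
  then have Fx: "norm (F x) \<le> L0 * (exp (L1 * D) * D)"
    using norm_le_exp_dist_zero[OF lip xs, of x] by (simp add: mult.assoc)
  show ?thesis
  proof (cases "L0 + L1 * norm (F x) = 0")
    case True
    then have "L0 = 0"
      using L by (simp add: add_nonneg_eq_0_iff)
    then show ?thesis
      using Fx by simp
  next
    case False
    then have pos: "0 < L0 + L1 * norm (F x)"
      using L by (simp add: order_less_le)
    have "L1 * norm (F x) \<le> L1 * (L0 * (exp (L1 * D) * D))"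
      using Fx L by (intro mult_left_mono)
    then have "L0 + L1 * norm (F x) \<le> L0 * (1 + L1 * exp (L1 * D) * D)"
      by (simp add: algebra_simps)
    then have "(L0 + L1 * norm (F x)) * (\<nu> / (L0 + L1 * norm (F x)) * norm (F x))
        \<le> L0 * (1 + L1 * exp (L1 * D) * D) * (\<nu> / (L0 + L1 * norm (F x)) * norm (F x))"
      using pos \<nu> by (intro mult_right_mono) auto
    then show ?thesis
      using False by simp
  qed
qed

section \<open>The convergence rate\<close>

theorem theorem4p4:
  fixes F :: "real ^ 'd \<Rightarrow> real ^ 'd"
    and xs :: "real ^ 'd"
    and x xhat :: "nat \<Rightarrow> real ^ 'd"
    and \<gamma> \<omega> :: "nat \<Rightarrow> real"
    and L0 L1 \<nu> :: real
    and K :: nat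
  assumes "monotone_operator F"
    and "one_symmetric_Lipschitz L0 L1 F"
    and "F xs = 0"
    and "\<nu> * exp \<nu> = 1 / sqrt 2"
    and "\<And>k. \<gamma> k = \<nu> / (L0 + L1 * norm (F (x k)))"
    and "\<And>k. \<omega> k = \<nu> / (L0 + L1 * norm (F (x k)))"
    and "extragradient F \<gamma> \<omega> x xhat"
  shows "Min ((\<lambda>k. (norm (F (x k)))\<^sup>2) ` {0..K})
    \<le> 2 * L0\<^sup>2 * (1 + L1 * exp (L1 * norm (x 0 - xs)) * norm (x 0 - xs))\<^sup>2 * (norm (x 0 - xs))\<^sup>2
        / (\<nu>\<^sup>2 * (real K + 1))"
proof -
  define D where "D = norm (x 0 - xs)"
  define B where "B = L0 * (1 + L1 * exp (L1 * D) * D)"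
  define a where "a k = (norm (F (x k)))\<^sup>2" for k
  have L: "0 \<le> L0" "0 \<le> L1"
    using assms(2) unfolding one_symmetric_Lipschitz_def by auto
  have "0 < \<nu> * exp \<nu>"
    using assms(4) by simp
  then have \<nu>: "0 < \<nu>"
    by (simp add: zero_less_mult_iff)
  have \<gamma>: "0 \<le> \<gamma> k" "\<gamma> k * (L0 + L1 * norm (F (x k))) \<le> \<nu>" for k
    using L \<nu> by (auto simp: assms(5))
  have xhat: "xhat k = x k - \<gamma> k *\<^sub>R F (x k)" for k
    using assms(7) unfolding extragradient_def by blast
  have x_Suc: "x (Suc k) = x k - \<gamma> k *\<^sub>R F (xhat k)" for k
    using assms(7) unfolding extragradient_def by (simp add: assms(5,6))
  have decrease: "(norm (x (Suc k) - xs))\<^sup>2 \<le> (norm (x k - xs))\<^sup>2 - (\<gamma> k)\<^sup>2 * a k / 2" for k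
    using extragradient_step_decrease[OF assms(1-4) \<gamma> xhat]
    unfolding a_def x_Suc .
  have drops: "(norm (x n - xs))\<^sup>2 + (\<Sum>k<n. (\<gamma> k)\<^sup>2 * a k / 2) \<le> D\<^sup>2" for n
  proof (induction n)
    case (Suc n)
    then show ?case
      using decrease[of n] by simp
  qed (simp add: D_def)
  have dist: "norm (x k - xs) \<le> D" for k
  proof (rule power2_le_imp_le)
    have "0 \<le> (\<Sum>i<k. (\<gamma> i)\<^sup>2 * a i / 2)"
      by (intro sum_nonneg) (simp add: a_def)
    then show "(norm (x k - xs))\<^sup>2 \<le> D\<^sup>2"
      using drops[of k] by linarith
  qed (simp add: D_def)
  have lower: "\<nu>\<^sup>2 * a k \<le> B\<^sup>2 * ((\<gamma> k)\<^sup>2 * a k)" for k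
  proof -
    have "\<nu> * norm (F (x k)) \<le> B * (\<gamma> k * norm (F (x k)))"
      using step_size_lower_bound[OF assms(2,3) \<nu> dist[of k]] by (simp add: B_def assms(5))
    then have "(\<nu> * norm (F (x k)))\<^sup>2 \<le> (B * (\<gamma> k * norm (F (x k))))\<^sup>2"
      using \<nu> by (intro power_mono) auto
    then show ?thesis
      by (simp add: a_def power_mult_distrib)
  qed
  define m where "m = Min (a ` {0..K})"
  have "m \<le> a k" if "k < Suc K" for k
    using that by (auto simp: m_def)
  then have "(\<Sum>k<Suc K. \<nu>\<^sup>2 * m) \<le> (\<Sum>k<Suc K. \<nu>\<^sup>2 * a k)"
    by (intro sum_mono mult_left_mono) auto
  also have "\<dots> \<le> (\<Sum>k<Suc K. B\<^sup>2 * ((\<gamma> k)\<^sup>2 * a k))"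
    by (intro sum_mono lower)
  also have "\<dots> = 2 * B\<^sup>2 * (\<Sum>k<Suc K. (\<gamma> k)\<^sup>2 * a k / 2)"
    unfolding sum_distrib_left by (intro sum.cong) auto
  also have "\<dots> \<le> 2 * B\<^sup>2 * D\<^sup>2"
  proof (rule mult_left_mono)
    show "(\<Sum>k<Suc K. (\<gamma> k)\<^sup>2 * a k / 2) \<le> D\<^sup>2"
      using drops[of "Suc K"] zero_le_power2[of "norm (x (Suc K) - xs)"] by linarith
  qed simp
  finally have "m * (\<nu>\<^sup>2 * (real K + 1)) \<le> 2 * B\<^sup>2 * D\<^sup>2"
    by (simp add: algebra_simps)
  then have "m \<le> 2 * B\<^sup>2 * D\<^sup>2 / (\<nu>\<^sup>2 * (real K + 1))"
    using \<nu> by (subst pos_le_divide_eq) auto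
  then show ?thesis
    unfolding m_def a_def B_def D_def power_mult_distrib mult.assoc .
qed

end
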